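(* Consider the baseline-category logit model with partial proportional odds: $\log(\pi_{ij}/\pi_{iJ})=\mathbf h_j^T(\mathbf x_i)\boldsymbol\beta_j+\mathbf h_c^T(\mathbf x_i)\boldsymbol\zeta$ for $i=1,\dots,m$, $j=1,\dots,J-1$. Suppose $\mathbf h_1(\mathbf x_i)=\cdots=\mathbf h_{J-1}(\mathbf x_i)$ for all $i=1,\dots,m$. Then all orders of response categories that keep $J$ invariant are equivalent; that is, $\sigma_1\sim\sigma_2$ for all permutations $\sigma_1,\sigma_2$ of $\{1,\dots,J\}$ with $\sigma_1(J)=\sigma_2(J)=J$.
   Context: Setting. Let $d\ge1$, $m\ge1$, $J\ge3$. The data are $\{(\mathbf x_i,\mathbf Y_i): i=1,\dots,m\}$, where $\mathbf x_1,\dots,\mathbf x_m\in\mathbb R^d$ are distinct covariate settings and $\mathbf Y_i=(Y_{i1},\dots,Y_{iJ})^T$ is a vector of nonnegative integer counts with $n_i=\sum_{j=1}^JY_{ij}>0$. The model assumes $\mathbf Y_i\sim\mathrm{Multinomial}(n_i;\pi_{i1},\dots,\pi_{iJ})$ independently over $i$, with $\pi_{ij}>0$ and $\sum_{j=1}^J\pi_{ij}=1$. Model. $\mathbf h_j:\mathbb R^d\to\mathbb R^{p_j}$ ($j=1,\dots,J-1$) and $\mathbf h_c:\mathbb R^d\to\mathbb R^{p_c}$ are known predictor functions (under the hypothesis of the claim, all $p_j$ are equal), and the unknown parameter is $\boldsymbol\theta=(\boldsymbol\beta_1^T,\dots,\boldsymbol\beta_{J-1}^T,\boldsymbol\zeta^T)^T$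 with $\boldsymbol\beta_j\in\mathbb R^{p_j}$, $\boldsymbol\zeta\in\mathbb R^{p_c}$, ranging over $\boldsymbol\Theta=\mathbb R^p$, $p=p_1+\cdots+p_{J-1}+p_c$. For $\boldsymbol\theta\in\boldsymbol\Theta$, $(\pi_{i1}(\boldsymbol\theta),\dots,\pi_{iJ}(\boldsymbol\theta))$ denotes the unique positive probability vector satisfying the model equations at $\mathbf x_i$. Orders and equivalence. An order is a permutation $\sigma$ of $\{1,\dots,J\}$. Fitting the model with order $\sigma$ means fitting it to the permuted data $\mathbf Y_i^\sigma=(Y_{i\sigma(1)},\dots,Y_{i\sigma(J)})^T$, so the likelihood function with order $\sigma$ is $$L_\sigma(\boldsymbol\theta)=\prod_{i=1}^m\frac{n_i!}{\prod_{j=1}^JY_{i\sigma(j)}!}\prod_{j=1}^J\pi_{ij}(\boldsymbol\theta)^{Y_{i\sigma(j)}} .$$ Two orders are equivalent, $\sigma_1\sim\sigma_2$, if $\sup_{\boldsymbol\theta\in\boldsymbol\Theta}L_{\sigma_1}(\boldsymbol\theta)=\sup_{\boldsymbol\theta\in\boldsymbol\Theta}L_{\sigma_2}(\boldsymbol\theta)$. *)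

theory Defs
  imports
    Complex_Main
    "HOL-Library.FuncSet"
    "HOL-Combinatorics.Permutations"
    "Jordan_Normal_Form.Matrix"
begin

text \<open>
  Covariate settings and response categories are numbered from 1, as in \<open>{1..m}\<close> and \<open>{1..J}\<close>.
  Real column vectors of dimension \<open>n\<close> are the elements of \<^term>\<open>carrier_vec n :: real vec set\<close>,
  and \<open>v \<bullet> w\<close> is the inner product of two such vectors.
\<close>

text \<open>
  A parameter is kept in block form: the family \<open>\<beta>\<^sub>1, \<dots>, \<beta>\<^sub>J\<^sub>-\<^sub>1\<close> paired with \<open>\<zeta>\<close>, instead of
  one concatenated vector of length \<open>p\<^sub>1 + \<dots> + p\<^sub>J\<^sub>-\<^sub>1 + p\<^sub>c\<close>.
\<close>

type_synonym parameter = "(nat \<Rightarrow> real vec) \<times> real vec"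

definition parameter_space :: "nat \<Rightarrow> (nat \<Rightarrow> nat) \<Rightarrow> nat \<Rightarrow> parameter set" where
  "parameter_space J p pc = (\<Pi>\<^sub>E j\<in>{1..J - 1}. carrier_vec (p j)) \<times> carrier_vec pc"

text \<open>
  The baseline-category logit equations with partial proportional odds at the covariate setting
  \<open>v\<close>. Extensionality pins down the irrelevant values of \<open>\<pi>\<close> outside \<open>{1..J}\<close>, so that the
  solution is unique.
\<close>

definition baseline_ppo ::
  "nat \<Rightarrow> (nat \<Rightarrow> real vec \<Rightarrow> real vec) \<Rightarrow> (real vec \<Rightarrow> real vec) \<Rightarrow> parameter \<Rightarrow> real vec
     \<Rightarrow> (nat \<Rightarrow> real) \<Rightarrow> bool" where
  "baseline_ppo J h hc \<theta> v \<pi> \<longleftrightarrow>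
     \<pi> \<in> extensional {1..J} \<and>
     (\<forall>j\<in>{1..J}. \<pi> j > 0) \<and>
     (\<Sum>j = 1..J. \<pi> j) = 1 \<and>
     (\<forall>j\<in>{1..J - 1}. ln (\<pi> j / \<pi> J) = h j v \<bullet> fst \<theta> j + hc v \<bullet> snd \<theta>)"

definition category_prob ::
  "nat \<Rightarrow> (nat \<Rightarrow> real vec \<Rightarrow> real vec) \<Rightarrow> (real vec \<Rightarrow> real vec) \<Rightarrow> parameter \<Rightarrow> real vec
     \<Rightarrow> nat \<Rightarrow> real" where
  "category_prob J h hc \<theta> v = (THE \<pi>. baseline_ppo J h hc \<theta> v \<pi>)"

definition likelihood ::
  "nat \<Rightarrow> nat \<Rightarrow> (nat \<Rightarrow> real vec) \<Rightarrow> (nat \<Rightarrow> nat \<Rightarrow> nat)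
     \<Rightarrow> (nat \<Rightarrow> real vec \<Rightarrow> real vec) \<Rightarrow> (real vec \<Rightarrow> real vec)
     \<Rightarrow> (nat \<Rightarrow> nat) \<Rightarrow> parameter \<Rightarrow> real" where
  "likelihood m J x Y h hc \<sigma> \<theta> =
     (\<Prod>i = 1..m.
        fact (\<Sum>j = 1..J. Y i j) / (\<Prod>j = 1..J. fact (Y i (\<sigma> j))) *
        (\<Prod>j = 1..J. category_prob J h hc \<theta> (x i) j ^ Y i (\<sigma> j)))"

definition equivalent_orders ::
  "nat \<Rightarrow> nat \<Rightarrow> (nat \<Rightarrow> real vec) \<Rightarrow> (nat \<Rightarrow> nat \<Rightarrow> nat) \<Rightarrow> (nat \<Rightarrow> nat) \<Rightarrow> nat
     \<Rightarrow> (nat \<Rightarrow> real vec \<Rightarrow> real vec) \<Rightarrow> (real vec \<Rightarrow> real vec)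
     \<Rightarrow> (nat \<Rightarrow> nat) \<Rightarrow> (nat \<Rightarrow> nat) \<Rightarrow> bool" where
  "equivalent_orders m J x Y p pc h hc \<sigma>\<^sub>1 \<sigma>\<^sub>2 \<longleftrightarrow>
     (SUP \<theta>\<in>parameter_space J p pc. likelihood m J x Y h hc \<sigma>\<^sub>1 \<theta>) =
     (SUP \<theta>\<in>parameter_space J p pc. likelihood m J x Y h hc \<sigma>\<^sub>2 \<theta>)"

text \<open>
  The next facts show that the definite description and the real-valued suprema above are
  meaningful: the model equations have exactly one solution, and the likelihood is bounded on
  the (nonempty) parameter space.
\<close>

lemma baseline_ppo_ex1:
  assumes "J \<ge> 1"
  shows "\<exists>!\<pi>. baseline_ppo J h hc \<theta> v \<pi>"
proof -
  define \<eta> where "\<eta> j = (if j = J then 0 else h j v \<bullet> fst \<theta> j + hc v \<bullet> snd \<theta>)" for j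
  define S where "S = (\<Sum>j = 1..J. exp (\<eta> j))"
  have S: "S > 0"
    unfolding S_def using assms by (intro sum_pos) auto
  have "baseline_ppo J h hc \<theta> v (\<lambda>j\<in>{1..J}. exp (\<eta> j) / S)"
  proof -
    have "(\<Sum>j = 1..J. exp (\<eta> j) / S) = 1"
      using S by (simp add: S_def flip: sum_divide_distrib)
    moreover have "ln ((exp (\<eta> j) / S) / (exp (\<eta> J) / S)) = h j v \<bullet> fst \<theta> j + hc v \<bullet> snd \<theta>"
      if "j \<in> {1..J - 1}" for j
      using that S by (auto simp: \<eta>_def)
    ultimately show ?thesis
      using S assms by (auto simp: baseline_ppo_def)
  qed
  moreover have "\<pi> = (\<lambda>j\<in>{1..J}. exp (\<eta> j) / S)" if *: "baseline_ppo J h hc \<theta> v \<pi>" for \<pi>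
  proof -
    have pos: "\<pi> j > 0" if "j \<in> {1..J}" for j
      using * that by (auto simp: baseline_ppo_def)
    have J: "\<pi> J > 0"
      using pos assms by auto
    have eq: "\<pi> j = \<pi> J * exp (\<eta> j)" if j: "j \<in> {1..J}" for j
    proof (cases "j = J")
      case False
      then have "ln (\<pi> j / \<pi> J) = \<eta> j"
        using * j by (auto simp: baseline_ppo_def \<eta>_def)
      moreover have "\<pi> j / \<pi> J > 0"
        using pos[OF j] J by simp
      ultimately have "\<pi> j / \<pi> J = exp (\<eta> j)"
        by (metis exp_ln)
      then show ?thesis
        using J by (simp add: field_simps)
    qed (simp add: \<eta>_def)
    have "1 = (\<Sum>j = 1..J. \<pi> j)"
      using * by (simp add: baseline_ppo_def)
    also have "\<dots> = \<pi> J * S"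
      unfolding S_def sum_distrib_left by (rule sum.cong[OF refl eq])
    finally have "\<pi> J = 1 / S"
      using S by (simp add: field_simps)
    then have "\<pi> j = exp (\<eta> j) / S" if "j \<in> {1..J}" for j
      using eq[OF that] by (metis mult.left_neutral times_divide_eq_left)
    moreover have "\<pi> \<in> extensional {1..J}"
      using * by (simp add: baseline_ppo_def)
    ultimately show ?thesis
      by (intro extensionalityI[of _ "{1..J}"]) auto
  qed
  ultimately show ?thesis by blast
qed

lemma baseline_ppo_category_prob:
  assumes "J \<ge> 1"
  shows "baseline_ppo J h hc \<theta> v (category_prob J h hc \<theta> v)"
  unfolding category_prob_def using baseline_ppo_ex1[OF assms] by (rule theI')

lemma parameter_space_nonempty: "parameter_space J p pc \<noteq> {}"
  unfolding parameter_space_def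
  by (auto simp: PiE_eq_empty_iff intro: zero_carrier_vec)

lemma bdd_above_likelihood:
  assumes "J \<ge> 1"
  shows "bdd_above (likelihood m J x Y h hc \<sigma> ` \<Theta>)"
proof (rule bdd_aboveI2)
  fix \<theta>
  have bounds: "0 \<le> category_prob J h hc \<theta> v j \<and> category_prob J h hc \<theta> v j \<le> 1"
    if j: "j \<in> {1..J}" for v j
  proof -
    let ?\<pi> = "category_prob J h hc \<theta> v"
    have pos: "?\<pi> k > 0" if "k \<in> {1..J}" for k
      using baseline_ppo_category_prob[OF assms] that unfolding baseline_ppo_def by blast
    have "?\<pi> j \<le> (\<Sum>k = 1..J. ?\<pi> k)"
      using j by (rule member_le_sum) (use pos in \<open>simp_all add: less_imp_le\<close>)
    also have "\<dots> = 1"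
      using baseline_ppo_category_prob[OF assms] unfolding baseline_ppo_def by blast
    finally show ?thesis
      using pos[OF j] by linarith
  qed
  show "likelihood m J x Y h hc \<sigma> \<theta> \<le>
    (\<Prod>i = 1..m. fact (\<Sum>j = 1..J. Y i j) / (\<Prod>j = 1..J. fact (Y i (\<sigma> j))))"
    unfolding likelihood_def
  proof (rule prod_mono)
    fix i
    let ?P = "\<Prod>j = 1..J. category_prob J h hc \<theta> (x i) j ^ Y i (\<sigma> j)"
    let ?c = "fact (\<Sum>j = 1..J. Y i j) / (\<Prod>j = 1..J. fact (Y i (\<sigma> j))) :: real"
    have P0: "0 \<le> ?P"
      by (intro prod_nonneg zero_le_power) (use bounds in blast)
    have P1: "?P \<le> 1"
      by (intro prod_le_1 conjI zero_le_power power_le_one) (use bounds in blast)+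
    have c: "0 \<le> ?c"
      by (intro divide_nonneg_nonneg prod_nonneg fact_ge_zero)
    show "0 \<le> ?c * ?P \<and> ?c * ?P \<le> ?c"
      using mult_nonneg_nonneg[OF c P0] mult_left_mono[OF P1 c] by (simp only: mult_1_right)
  qed
qed

end

theory Submission
  imports Defs
begin

text \<open>
  With common predictor functions, permuting the blocks \<open>\<beta>\<^sub>1, \<dots>, \<beta>\<^sub>J\<^sub>-\<^sub>1\<close> of a parameter permutes the
  category probabilities in the same way. Hence a change of order that fixes the baseline \<open>J\<close> is
  undone by a reparametrization of the parameter space, and the two likelihood functions take the
  same values.
\<close>

definition permute_parameter :: "nat \<Rightarrow> (nat \<Rightarrow> nat) \<Rightarrow> parameter \<Rightarrow> parameter" where
  "permute_parameter J \<tau> \<theta> = (restrict (fst \<theta> \<circ> \<tau>) {1..J - 1}, snd \<theta>)"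

lemma permutes_fixing_last_in:
  fixes \<tau> :: "nat \<Rightarrow> nat"
  assumes "\<tau> permutes {1..J}" "\<tau> J = J" "j \<in> {1..J - 1}"
  shows "\<tau> j \<in> {1..J - 1}"
proof -
  have "\<tau> j \<in> {1..J}"
    using permutes_in_image[OF assms(1), of j] assms(3) by auto
  moreover have "\<tau> j \<noteq> J"
  proof
    assume "\<tau> j = J"
    then have "j = J"
      using assms(2) permutes_inj[OF assms(1)] by (metis injD)
    with assms(3) show False
      by auto
  qed
  ultimately show ?thesis
    by auto
qed

text \<open>Block \<open>j\<close> of the new parameter is the old block \<open>\<tau> j\<close>, of
  dimension \<open>p (\<tau> j)\<close>. It fits slot \<open>j\<close> because all these dimensions
  agree.\<close>

lemma permute_parameter_in_space:
  assumes "\<tau> permutes {1..J}" "\<tau> J = J"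
    and "\<And>j k. j \<in> {1..J - 1} \<Longrightarrow> k \<in> {1..J - 1} \<Longrightarrow> p j = p k"
    and "\<theta> \<in> parameter_space J p pc"
  shows "permute_parameter J \<tau> \<theta> \<in> parameter_space J p pc"
proof -
  have "fst \<theta> (\<tau> j) \<in> carrier_vec (p j)" if "j \<in> {1..J - 1}" for j
  proof -
    have "\<tau> j \<in> {1..J - 1}"
      using permutes_fixing_last_in[OF assms(1,2) that] .
    moreover from this have "fst \<theta> (\<tau> j) \<in> carrier_vec (p (\<tau> j))"
      using assms(4) by (auto simp: parameter_space_def PiE_iff)
    ultimately show ?thesis
      using assms(3)[OF that, of "\<tau> j"] by simp
  qed
  \<comment> \<open>The \<open>restrict\<close> in \<open>permute_parameter\<close> provides the
    extensionality demanded by the product in \<open>parameter_space\<close>.\<close>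
  then show ?thesis
    using assms(4) by (auto simp: parameter_space_def permute_parameter_def)
qed

text \<open>The model equations have exactly one solution, so it is enough to check that the
  permuted probability vector solves them at the permuted parameter.\<close>

lemma category_prob_permute_parameter:
  assumes "J \<ge> 1" "\<tau> permutes {1..J}" "\<tau> J = J"
    and "\<And>j k. j \<in> {1..J - 1} \<Longrightarrow> k \<in> {1..J - 1} \<Longrightarrow> h j v = h k v"
  shows "category_prob J h hc (permute_parameter J \<tau> \<theta>) v = category_prob J h hc \<theta> v \<circ> \<tau>"
proof -
  let ?\<pi> = "category_prob J h hc \<theta> v"
  have \<pi>: "baseline_ppo J h hc \<theta> v ?\<pi>"
    by (rule baseline_ppo_category_prob[OF assms(1)])
  \<comment> \<open>Outside \<open>{1..J}\<close> the permutation is the identity, so the value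
    \<open>undefined\<close> is kept there.\<close>
  have "?\<pi> \<circ> \<tau> \<in> extensional {1..J}"
    using \<pi> permutes_not_in[OF assms(2)] by (auto simp: baseline_ppo_def extensional_def)
  moreover have "?\<pi> (\<tau> j) > 0" if "j \<in> {1..J}" for j
    using \<pi> permutes_in_image[OF assms(2)] that unfolding baseline_ppo_def by blast
  moreover have "(\<Sum>j = 1..J. ?\<pi> (\<tau> j)) = 1"
    using \<pi> sum.permute[OF assms(2), of ?\<pi>] by (simp add: baseline_ppo_def)
  moreover have "ln (?\<pi> (\<tau> j) / ?\<pi> (\<tau> J))
      = h j v \<bullet> fst (permute_parameter J \<tau> \<theta>) j + hc v \<bullet> snd (permute_parameter J \<tau> \<theta>)"
    if j: "j \<in> {1..J - 1}" for j
  proof -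
    have \<tau>j: "\<tau> j \<in> {1..J - 1}"
      using permutes_fixing_last_in[OF assms(2,3) j] .
    \<comment> \<open>This is the equation of category \<open>\<tau> j\<close> at the old parameter.
      It becomes equation \<open>j\<close> at the new one: the baseline is fixed by
      \<open>\<tau>\<close>, the predictors of \<open>j\<close> and \<open>\<tau> j\<close> coincide
      at \<open>v\<close>, and the term with \<open>hc\<close> is common to all categories.\<close>
    then have "ln (?\<pi> (\<tau> j) / ?\<pi> J) = h (\<tau> j) v \<bullet> fst \<theta> (\<tau> j) + hc v \<bullet> snd \<theta>"
      using \<pi> unfolding baseline_ppo_def by blast
    then show ?thesis
      using j assms(3) assms(4)[OF j \<tau>j] by (simp add: permute_parameter_def)
  qed
  ultimately have "baseline_ppo J h hc (permute_parameter J \<tau> \<theta>) v (?\<pi> \<circ> \<tau>)"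
    by (simp add: baseline_ppo_def)
  then show ?thesis
    unfolding category_prob_def[of J h hc "permute_parameter J \<tau> \<theta>"]
    by (rule the1_equality[OF baseline_ppo_ex1[OF assms(1)]])
qed

text \<open>For each \<open>i\<close>, counts and probabilities are permuted by the same
  \<open>\<tau>\<close>, so both products over categories are only reindexed. The factorial of the
  total count does not involve the order.\<close>

lemma likelihood_permute_parameter:
  assumes "J \<ge> 1" "\<tau> permutes {1..J}" "\<tau> J = J"
    and "\<And>i j k. \<lbrakk>i \<in> {1..m}; j \<in> {1..J - 1}; k \<in> {1..J - 1}\<rbrakk> \<Longrightarrow> h j (x i) = h k (x i)"
  shows "likelihood m J x Y h hc (\<sigma> \<circ> \<tau>) (permute_parameter J \<tau> \<theta>) = likelihood m J x Y h hc \<sigma> \<theta>"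
  unfolding likelihood_def
proof (rule prod.cong[OF refl])
  fix i
  assume i: "i \<in> {1..m}"
  let ?\<pi> = "category_prob J h hc \<theta> (x i)"
  have "(\<Prod>j = 1..J. fact (Y i ((\<sigma> \<circ> \<tau>) j))) = (\<Prod>j = 1..J. fact (Y i (\<sigma> j)) :: real)"
    using prod.permute[OF assms(2), of "\<lambda>j. fact (Y i (\<sigma> j)) :: real"] by (simp add: o_def)
  moreover have "(\<Prod>j = 1..J. (?\<pi> \<circ> \<tau>) j ^ Y i ((\<sigma> \<circ> \<tau>) j)) = (\<Prod>j = 1..J. ?\<pi> j ^ Y i (\<sigma> j))"
    using prod.permute[OF assms(2), of "\<lambda>j. ?\<pi> j ^ Y i (\<sigma> j)"] by (simp add: o_def)
  moreover have "category_prob J h hc (permute_parameter J \<tau> \<theta>) (x i) = ?\<pi> \<circ> \<tau>"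
    by (rule category_prob_permute_parameter[OF assms(1-3)]) (rule assms(4)[OF i])
  ultimately show "fact (\<Sum>j = 1..J. Y i j) / (\<Prod>j = 1..J. fact (Y i ((\<sigma> \<circ> \<tau>) j))) *
      (\<Prod>j = 1..J. category_prob J h hc (permute_parameter J \<tau> \<theta>) (x i) j ^ Y i ((\<sigma> \<circ> \<tau>) j)) =
      fact (\<Sum>j = 1..J. Y i j) / (\<Prod>j = 1..J. fact (Y i (\<sigma> j))) *
      (\<Prod>j = 1..J. ?\<pi> j ^ Y i (\<sigma> j))"
    by (simp only:)
qed

text \<open>The hypotheses are symmetric in \<open>\<sigma>\<close> and \<open>\<sigma>'\<close>, so
  this one inclusion also yields the reverse one.\<close>

lemma likelihood_image_subset:
  assumes "J \<ge> 1"
    and "\<And>j k. j \<in> {1..J - 1} \<Longrightarrow> k \<in> {1..J - 1} \<Longrightarrow> p j = p k"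
    and "\<And>i j k. \<lbrakk>i \<in> {1..m}; j \<in> {1..J - 1}; k \<in> {1..J - 1}\<rbrakk> \<Longrightarrow> h j (x i) = h k (x i)"
    and "\<sigma> permutes {1..J}" "\<sigma> J = J" "\<sigma>' permutes {1..J}" "\<sigma>' J = J"
  shows "likelihood m J x Y h hc \<sigma> ` parameter_space J p pc
    \<subseteq> likelihood m J x Y h hc \<sigma>' ` parameter_space J p pc"
proof (rule image_subsetI)
  fix \<theta>
  assume \<theta>: "\<theta> \<in> parameter_space J p pc"
  \<comment> \<open>This choice solves \<open>\<sigma> \<circ> \<tau> = \<sigma>'\<close>; it fixes
    \<open>J\<close> because both orders do.\<close>
  define \<tau> where "\<tau> = inv_into UNIV \<sigma> \<circ> \<sigma>'"
  have \<tau>: "\<tau> permutes {1..J}"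
    unfolding \<tau>_def using assms by (intro permutes_compose permutes_inv)
  have \<tau>J: "\<tau> J = J"
    using permutes_inverses(2)[OF assms(4), of J] assms by (simp add: \<tau>_def)
  have "\<sigma> \<circ> \<tau> = \<sigma>'"
    using permutes_inverses(1)[OF assms(4)] by (simp add: \<tau>_def fun_eq_iff)
  then have "likelihood m J x Y h hc \<sigma> \<theta> = likelihood m J x Y h hc \<sigma>' (permute_parameter J \<tau> \<theta>)"
    using likelihood_permute_parameter[OF assms(1) \<tau> \<tau>J, of m h x Y hc \<sigma> \<theta>, OF assms(3)] by simp
  then show "likelihood m J x Y h hc \<sigma> \<theta> \<in> likelihood m J x Y h hc \<sigma>' ` parameter_space J p pc"
    using permute_parameter_in_space[OF \<tau> \<tau>J assms(2) \<theta>] by blast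
qed

theorem theorem2p2:
  fixes d m J pc :: nat
    and p :: "nat \<Rightarrow> nat"
    and x :: "nat \<Rightarrow> real vec"
    and Y :: "nat \<Rightarrow> nat \<Rightarrow> nat"
    and h :: "nat \<Rightarrow> real vec \<Rightarrow> real vec"
    and hc :: "real vec \<Rightarrow> real vec"
    and \<sigma>\<^sub>1 \<sigma>\<^sub>2 :: "nat \<Rightarrow> nat"
  assumes "d \<ge> 1" and "m \<ge> 1" and "J \<ge> 3"
    and "x \<in> {1..m} \<rightarrow> carrier_vec d"
    and "inj_on x {1..m}"
    and "\<And>i. i \<in> {1..m} \<Longrightarrow> (\<Sum>j = 1..J. Y i j) > 0"
    and "\<And>j. j \<in> {1..J - 1} \<Longrightarrow> h j \<in> carrier_vec d \<rightarrow> carrier_vec (p j)"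
    and "hc \<in> carrier_vec d \<rightarrow> carrier_vec pc"
    and "\<And>i j k. \<lbrakk>i \<in> {1..m}; j \<in> {1..J - 1}; k \<in> {1..J - 1}\<rbrakk> \<Longrightarrow> h j (x i) = h k (x i)"
    and "\<sigma>\<^sub>1 permutes {1..J}" and "\<sigma>\<^sub>1 J = J"
    and "\<sigma>\<^sub>2 permutes {1..J}" and "\<sigma>\<^sub>2 J = J"
  shows "equivalent_orders m J x Y p pc h hc \<sigma>\<^sub>1 \<sigma>\<^sub>2"
proof -
  have J: "J \<ge> 1"
    using \<open>J \<ge> 3\<close> by simp
  \<comment> \<open>Equal block dimensions follow from the common predictor value at
    \<open>x 1\<close>, which exists since \<open>m \<ge> 1\<close>: one vector lies in both
    \<open>carrier_vec (p j)\<close> and \<open>carrier_vec (p k)\<close>.\<close>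
  have p: "p j = p k" if "j \<in> {1..J - 1}" "k \<in> {1..J - 1}" for j k
  proof -
    have m: "1 \<in> {1..m}"
      using \<open>m \<ge> 1\<close> by simp
    then have "x 1 \<in> carrier_vec d"
      using assms(4) by blast
    then have "h j (x 1) \<in> carrier_vec (p j)" "h k (x 1) \<in> carrier_vec (p k)"
      using assms(7)[OF that(1)] assms(7)[OF that(2)] by auto
    then show ?thesis
      using assms(9)[OF m that] by (metis carrier_vecD)
  qed
  \<comment> \<open>The suprema are compared through the sets of attained values, which
    coincide.\<close>
  have "likelihood m J x Y h hc \<sigma>\<^sub>1 ` parameter_space J p pc
      = likelihood m J x Y h hc \<sigma>\<^sub>2 ` parameter_space J p pc"
    by (intro subset_antisym likelihood_image_subset J p assms(9-13))
  then show ?thesis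
    by (simp add: equivalent_orders_def)
qed

end
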